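(* Let $\mathcal{P}=\{H_k\}_{k=0}^\infty$ be the sequence of Hermite polynomials, and for each $k\ge 1$ let $M_k$ be the maximal zero of $H_k$. Then, for each $k\in\mathbb{N}$, $\mathscr{T}_k(\mathcal{P};x)\neq 0$ for every $x\in\mathbb{C}$ with $|\operatorname{Re} x|>M_{k+1}$.
   Context: $\mathbb{N}=\{0,1,2,\dots\}$ and $D=\partial/\partial x$. The Hermite polynomials are given by $H_k(x)=(-1)^k e^{x^2}D^k e^{-x^2}$; all zeros of $H_k$ are real. For a sequence of polynomials $\mathcal{P}=\{P_k\}_{k=0}^\infty$, the $k$-th Turán expression is $$\mathscr{T}_k(\mathcal{P};x)=(P_{k+1}(x))^2-P_{k+2}(x)P_k(x),\qquad k\in\mathbb{N}.$$ *)

theory Defs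
  imports "HOL-Analysis.Analysis" "HOL-Computational_Algebra.Polynomial"
begin

definition hermite :: "nat \<Rightarrow> complex poly" where
  "hermite k = (THE p. \<forall>x. poly p x =
     (-1) ^ k * exp (x ^ 2) * (deriv ^^ k) (\<lambda>t. exp (- (t ^ 2))) x)"

(* The description above is proper: such a polynomial exists and is unique. *)

lemma deriv_gauss_poly:
  "\<exists>p. (deriv ^^ k) (\<lambda>t::complex. exp (- (t ^ 2))) =
     (\<lambda>x. (-1) ^ k * poly p x * exp (- (x ^ 2)))"
proof (induction k)
  case 0
  show ?case by (rule exI[of _ 1]) simp
next
  case (Suc k)
  then obtain p where p: "(deriv ^^ k) (\<lambda>t::complex. exp (- (t ^ 2))) =
     (\<lambda>x. (-1) ^ k * poly p x * exp (- (x ^ 2)))" by blast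
  have "deriv (\<lambda>x. (-1) ^ k * poly p x * exp (- (x ^ 2))) x =
      (-1) ^ Suc k * poly ([:0, 2:] * p - pderiv p) x * exp (- (x ^ 2))" for x
    by (rule DERIV_imp_deriv) (auto intro!: derivative_eq_intros simp: algebra_simps)
  then have "(deriv ^^ Suc k) (\<lambda>t::complex. exp (- (t ^ 2))) =
      (\<lambda>x. (-1) ^ Suc k * poly ([:0, 2:] * p - pderiv p) x * exp (- (x ^ 2)))"
    unfolding funpow.simps comp_def p by (rule ext)
  then show ?case by (rule exI)
qed

lemma poly_hermite:
  "poly (hermite k) x = (-1) ^ k * exp (x ^ 2) * (deriv ^^ k) (\<lambda>t. exp (- (t ^ 2))) x"
proof -
  let ?P = "\<lambda>p::complex poly. \<forall>x. poly p x =
     (-1) ^ k * exp (x ^ 2) * (deriv ^^ k) (\<lambda>t. exp (- (t ^ 2))) x"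
  obtain p where p: "(deriv ^^ k) (\<lambda>t::complex. exp (- (t ^ 2))) =
     (\<lambda>x. (-1) ^ k * poly p x * exp (- (x ^ 2)))" using deriv_gauss_poly by blast
  have "?P p"
    unfolding p by (simp add: exp_minus field_simps flip: power_mult_distrib)
  moreover have "q = p" if "?P q" for q
    using that \<open>?P p\<close> by (metis poly_eq_poly_eq_iff ext)
  ultimately have "?P (hermite k)" unfolding hermite_def by (rule theI)
  then show ?thesis by blast
qed

(* All zeros of the Hermite polynomials are real, so only real zeros enter here;
   Max is meaningful since they are finite in number and exist when k is at least 1. *)
definition max_zero :: "complex poly \<Rightarrow> real" where
  "max_zero p = Max {t. poly p (of_real t) = 0}"

definition turan :: "(nat \<Rightarrow> complex poly) \<Rightarrow> nat \<Rightarrow> complex \<Rightarrow> complex" where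
  "turan P k x = (poly (P (k + 1)) x) ^ 2 - poly (P (k + 2)) x * poly (P k) x"

end

theory Submission
  imports Defs "HOL-Computational_Algebra.Fundamental_Theorem_Algebra"
begin

text \<open>
  Write \<open>H = H\<^sub>n\<close> with \<open>n = k + 1\<close>. The relations \<open>H\<^sub>n\<^sub>+\<^sub>1 = 2x H\<^sub>n - H\<^sub>n'\<close> and \<open>H\<^sub>n' = 2n H\<^sub>n\<^sub>-\<^sub>1\<close> turn
  the Turan expression into \<open>(H'\<^sup>2 - H H'') / (2n) = H\<^sup>2 (\<Sum> 1 / (x - a)\<^sup>2) / (2n)\<close>, the sum ranging over
  the zeros \<open>a\<close> of \<open>H\<close>. These are real and lie in \<open>[-M, M]\<close>, where \<open>M\<close> is the maximal one. When
  \<open>\<bar>Re x\<bar> > M\<close>, all \<open>x - a\<close> lie in the same open quadrant (or are real), so all the \<open>1 / (x - a)\<^sup>2\<close> lie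
  in the same open half plane (or are positive) and cannot cancel.
\<close>

section \<open>Logarithmic derivatives of products of linear factors\<close>

lemma pderiv_linear_mult: "pderiv ([:c, d:] * p) = [:c, d:] * pderiv p + smult d p"
  by (simp only: pderiv_mult pderiv_pCons) (simp add: algebra_simps)

text \<open>The logarithmic derivative turns the product into a sum; the multiset \<open>A\<close>
  repeats each zero according to its multiplicity.\<close>

lemma poly_pderiv_prod_linear:
  fixes A :: "complex multiset"
  defines "q \<equiv> \<Prod>a\<in>#A. [:- a, 1:]"
  assumes "x \<notin># A"
  shows "poly (pderiv q) x = poly q x * (\<Sum>a\<in>#A. 1 / (x - a))"
  using assms(2) unfolding q_def
proof (induction A)
  case empty
  then show ?case by simp
next
  case (add b A)
  define r where "r = (\<Prod>a\<in>#A. [:- a, 1:])"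
  define S where "S = (\<Sum>a\<in>#A. 1 / (x - a))"
  have inv: "(x - b) * (1 / (x - b)) = 1" using add.prems by auto
  have IH: "poly (pderiv r) x = poly r x * S"
    using add unfolding r_def S_def by auto
  have d0: "poly ([:- b, 1:] * r) x = (x - b) * poly r x"
    by (simp add: algebra_simps)
  have "poly (pderiv ([:- b, 1:] * r)) x = (x - b) * poly (pderiv r) x + poly r x"
    unfolding pderiv_linear_mult by (simp add: algebra_simps)
  also have "\<dots> = poly ([:- b, 1:] * r) x * (1 / (x - b) + S)"
    unfolding IH d0 using inv by algebra
  finally show ?case by (simp add: r_def S_def)
qed

text \<open>Both sides are \<open>- q^2 * (q' / q)'\<close>. In the induction,
  \<open>q = l * r\<close> gives \<open>q'^2 - q * q'' = l^2 * (r'^2 - r * r'') + r^2 * (l'^2 - l *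
  l'')\<close>, where the last bracket is 1 for a monic linear \<open>l\<close>.\<close>

lemma poly_pderiv_square_diff_prod_linear:
  fixes A :: "complex multiset"
  defines "q \<equiv> \<Prod>a\<in>#A. [:- a, 1:]"
  assumes "x \<notin># A"
  shows "poly (pderiv q) x ^ 2 - poly q x * poly (pderiv (pderiv q)) x
           = poly q x ^ 2 * (\<Sum>a\<in>#A. (1 / (x - a)) ^ 2)"
  using assms(2) unfolding q_def
proof (induction A)
  case empty
  then show ?case by simp
next
  case (add b A)
  define r where "r = (\<Prod>a\<in>#A. [:- a, 1:])"
  define S where "S = (\<Sum>a\<in>#A. (1 / (x - a)) ^ 2)"
  have inv: "(x - b) * (1 / (x - b)) = 1" using add.prems by auto
  have IH: "poly (pderiv r) x ^ 2 - poly r x * poly (pderiv (pderiv r)) x = poly r x ^ 2 * S"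
    using add unfolding r_def S_def by auto
  have d1: "poly (pderiv ([:- b, 1:] * r)) x = (x - b) * poly (pderiv r) x + poly r x"
    unfolding pderiv_linear_mult by (simp add: algebra_simps)
  have d2: "poly (pderiv (pderiv ([:- b, 1:] * r))) x
      = (x - b) * poly (pderiv (pderiv r)) x + 2 * poly (pderiv r) x"
    unfolding pderiv_linear_mult pderiv_add pderiv_smult by (simp add: algebra_simps)
  have d0: "poly ([:- b, 1:] * r) x = (x - b) * poly r x"
    by (simp add: algebra_simps)
  have "poly (pderiv ([:- b, 1:] * r)) x ^ 2
        - poly ([:- b, 1:] * r) x * poly (pderiv (pderiv ([:- b, 1:] * r))) x
      = (x - b) ^ 2 * (poly (pderiv r) x ^ 2 - poly r x * poly (pderiv (pderiv r)) x)
        + poly r x ^ 2"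
    unfolding d0 d1 d2 by algebra
  also have "\<dots> = poly ([:- b, 1:] * r) x ^ 2 * ((1 / (x - b)) ^ 2 + S)"
    unfolding IH d0 using inv by algebra
  finally show ?case by (simp add: r_def S_def)
qed

text \<open>Over the complex numbers \<open>p\<close> is a constant times a product of linear
  factors; the constant scales both sides of the first identity linearly and of the second
  quadratically.\<close>

lemma complex_poly_log_derivs:
  fixes p :: "complex poly"
  assumes "p \<noteq> 0"
  obtains A where "size A = degree p" "\<And>a. a \<in># A \<longleftrightarrow> poly p a = 0"
    "\<And>x. poly p x \<noteq> 0 \<Longrightarrow> poly (pderiv p) x = poly p x * (\<Sum>a\<in>#A. 1 / (x - a))"
    "\<And>x. poly p x \<noteq> 0 \<Longrightarrow> poly (pderiv p) x ^ 2 - poly p x * poly (pderiv (pderiv p)) x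
             = poly p x ^ 2 * (\<Sum>a\<in>#A. (1 / (x - a)) ^ 2)"
proof -
  obtain A where "size A = degree p" and A: "p = smult (lead_coeff p) (\<Prod>a\<in>#A. [:- a, 1:])"
    using alg_closed_imp_factorization[OF assms] by blast
  define c q where "c = lead_coeff p" and "q = (\<Prod>a\<in>#A. [:- a, 1:])"
  have p: "p = smult c q" using A unfolding c_def q_def .
  have "c \<noteq> 0" using assms unfolding c_def by simp
  have "poly q a = 0 \<longleftrightarrow> a \<in># A" for a
    unfolding q_def by (induction A) auto
  then have roots: "a \<in># A \<longleftrightarrow> poly p a = 0" for a
    using \<open>c \<noteq> 0\<close> unfolding p by simp
  have "poly (pderiv p) x = poly p x * (\<Sum>a\<in>#A. 1 / (x - a))" if "poly p x \<noteq> 0" for x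
    using poly_pderiv_prod_linear[of x A] roots[of x] that
    unfolding p q_def[symmetric] by (simp add: pderiv_smult)
  moreover have "poly (pderiv p) x ^ 2 - poly p x * poly (pderiv (pderiv p)) x
      = poly p x ^ 2 * (\<Sum>a\<in>#A. (1 / (x - a)) ^ 2)" if "poly p x \<noteq> 0" for x
  proof -
    have "poly (pderiv q) x ^ 2 - poly q x * poly (pderiv (pderiv q)) x
        = poly q x ^ 2 * (\<Sum>a\<in>#A. (1 / (x - a)) ^ 2)"
      using poly_pderiv_square_diff_prod_linear[of x A] roots[of x] that
      unfolding q_def by simp
    moreover have "poly (pderiv p) x ^ 2 - poly p x * poly (pderiv (pderiv p)) x
        = c ^ 2 * (poly (pderiv q) x ^ 2 - poly q x * poly (pderiv (pderiv q)) x)"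
      unfolding p pderiv_smult poly_smult by algebra
    ultimately show ?thesis unfolding p poly_smult by (simp add: power_mult_distrib)
  qed
  ultimately show thesis using that \<open>size A = degree p\<close> roots by blast
qed

section \<open>Sums over multisets\<close>

lemma sum_mset_pos:
  fixes f :: "'a \<Rightarrow> 'b::ordered_comm_monoid_add"
  assumes "A \<noteq> {#}" "\<And>a. a \<in># A \<Longrightarrow> f a > 0"
  shows "(\<Sum>a\<in>#A. f a) > 0"
  using assms
proof (induction A)
  case (add b A)
  then show ?case by (cases "A = {#}") (auto intro!: add_pos_pos)
qed simp

lemma Re_sum_mset: "Re (\<Sum>a\<in>#A. f a) = (\<Sum>a\<in>#A. Re (f a))"
  by (induction A) auto

lemma Im_sum_mset: "Im (\<Sum>a\<in>#A. f a) = (\<Sum>a\<in>#A. Im (f a))"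
  by (induction A) auto

section \<open>Differential relations between Hermite polynomials\<close>

lemma hermite_0: "hermite 0 = 1"
proof -
  have "poly (hermite 0) = poly 1"
    by (rule ext) (simp add: poly_hermite exp_minus)
  then show ?thesis by (simp only: poly_eq_poly_eq_iff)
qed

text \<open>Differentiate \<open>(-1)^k * H_k(x) * exp (- x^2)\<close> once more: the exponential
  contributes the factor \<open>- 2 * x\<close>, the polynomial its derivative.\<close>

lemma hermite_Suc: "hermite (Suc k) = [:0, 2:] * hermite k - pderiv (hermite k)"
proof -
  have sq: "(-1) ^ k * (-1) ^ k = (1::complex)" by (simp flip: power_mult_distrib)
  \<comment> \<open>The defining formula solved for the derivative of the Gaussian.\<close>
  have d: "(deriv ^^ k) (\<lambda>t. exp (- (t ^ 2))) =
      (\<lambda>x. (-1) ^ k * poly (hermite k) x * exp (- (x ^ 2)))"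
  proof
    fix x :: complex
    have "(-1) ^ k * poly (hermite k) x * exp (- (x ^ 2))
        = ((-1) ^ k * (-1) ^ k) * (exp (x ^ 2) * exp (- (x ^ 2))) * (deriv ^^ k) (\<lambda>t. exp (- (t ^ 2))) x"
      unfolding poly_hermite by (simp only: mult_ac)
    then show "(deriv ^^ k) (\<lambda>t. exp (- (t ^ 2))) x
        = (-1) ^ k * poly (hermite k) x * exp (- (x ^ 2))"
      by (simp add: sq flip: exp_add)
  qed
  have "deriv (\<lambda>x. (-1) ^ k * poly (hermite k) x * exp (- (x ^ 2))) x =
      (-1) ^ Suc k * poly ([:0, 2:] * hermite k - pderiv (hermite k)) x * exp (- (x ^ 2))" for x
    by (rule DERIV_imp_deriv) (auto intro!: derivative_eq_intros simp: algebra_simps)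
  then have "(deriv ^^ Suc k) (\<lambda>t. exp (- (t ^ 2))) x =
      (-1) ^ Suc k * poly ([:0, 2:] * hermite k - pderiv (hermite k)) x * exp (- (x ^ 2))" for x
    unfolding funpow.simps comp_def d by simp
  then have "poly (hermite (Suc k)) x = ((-1) ^ k * (-1) ^ k) * (exp (x ^ 2) * exp (- (x ^ 2)))
      * poly ([:0, 2:] * hermite k - pderiv (hermite k)) x" for x
    unfolding poly_hermite[of "Suc k"] by (simp only: power_Suc mult_ac) simp
  then have "poly (hermite (Suc k)) = poly ([:0, 2:] * hermite k - pderiv (hermite k))"
    by (intro ext) (simp add: sq flip: exp_add)
  then show ?thesis by (simp only: poly_eq_poly_eq_iff)
qed

text \<open>Differentiating the relation \<open>hermite_Suc\<close> leaves first and second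
  derivatives of \<open>H_(k+1)\<close>; the induction hypothesis reduces them to \<open>H_k\<close>
  and its derivative, which the same relation reassembles into \<open>H_(k+1)\<close>.\<close>

lemma pderiv_hermite_Suc: "pderiv (hermite (Suc k)) = smult (2 * of_nat (Suc k)) (hermite k)"
proof (induction k)
  case 0
  show ?case by (simp add: hermite_Suc hermite_0 pderiv_pCons pderiv_diff pderiv_mult one_pCons)
next
  case (Suc k)
  have "poly (pderiv (hermite (Suc (Suc k)))) x
      = poly (smult (2 * of_nat (Suc (Suc k))) (hermite (Suc k))) x" for x
  proof -
    have "poly (pderiv (hermite (Suc (Suc k)))) x
        = 2 * poly (hermite (Suc k)) x + 2 * x * poly (pderiv (hermite (Suc k))) x
          - poly (pderiv (pderiv (hermite (Suc k)))) x"
      unfolding hermite_Suc[of "Suc k"] pderiv_diff pderiv_linear_mult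
      by (simp add: algebra_simps)
    also have "\<dots> = 2 * poly (hermite (Suc k)) x
        + 2 * of_nat (Suc k) * (2 * x * poly (hermite k) x - poly (pderiv (hermite k)) x)"
      unfolding Suc.IH pderiv_smult poly_smult by (simp add: algebra_simps)
    also have "2 * x * poly (hermite k) x - poly (pderiv (hermite k)) x = poly (hermite (Suc k)) x"
      by (simp add: hermite_Suc)
    finally show ?thesis by (simp add: algebra_simps)
  qed
  then show ?case by (metis poly_eq_poly_eq_iff ext)
qed

lemma hermite_nonzero: "hermite k \<noteq> 0"
proof (induction k)
  case 0
  show ?case by (simp add: hermite_0)
next
  case (Suc k)
  show ?case
  proof
    assume "hermite (Suc k) = 0"
    with pderiv_hermite_Suc[of k] have "smult (2 * of_nat (Suc k)) (hermite k) = 0" by simp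
    with Suc show False by (simp del: of_nat_Suc)
  qed
qed

text \<open>Ensures that the sum over the zeros of \<open>H_(k+1)\<close> is not empty.\<close>

lemma degree_hermite_Suc: "degree (hermite (Suc k)) \<noteq> 0"
proof
  assume "degree (hermite (Suc k)) = 0"
  then have "pderiv (hermite (Suc k)) = 0" by (simp add: pderiv_eq_0_iff)
  with hermite_nonzero[of k] show False
    by (simp add: pderiv_hermite_Suc del: of_nat_Suc)
qed

section \<open>Parity of the polynomials and location of their zeros\<close>

lemma poly_hermite_minus: "poly (hermite k) (- x) = (-1) ^ k * poly (hermite k) x"
proof (induction k rule: induct_nat_012)
  case (ge2 n)
  \<comment> \<open>Three-term recurrence: both terms on the right have the parity of
    \<open>n\<close>, hence the two-step induction.\<close>
  have rec: "poly (hermite (Suc (Suc n))) y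
      = 2 * y * poly (hermite (Suc n)) y - 2 * of_nat (Suc n) * poly (hermite n) y" for y
    unfolding hermite_Suc[of "Suc n"] by (simp add: pderiv_hermite_Suc del: of_nat_Suc)
  show ?case unfolding rec ge2 by (simp add: algebra_simps)
qed (simp_all add: hermite_0 hermite_Suc)

text \<open>
  If \<open>x\<close> is not real and the zeros \<open>a\<close> of \<open>H\<^sub>k\<close> are real, then the imaginary part of
  \<open>H\<^sub>k\<^sub>+\<^sub>1(x) / H\<^sub>k(x) = 2x - \<Sum> 1 / (x - a)\<close> is at least twice that of \<open>x\<close> in absolute value.
\<close>

lemma hermite_zeros_real:
  assumes "poly (hermite k) x = 0"
  shows "Im x = 0"
  using assms
proof (induction k arbitrary: x)
  case 0
  then show ?case by (simp add: hermite_0)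
next
  case (Suc k)
  show ?case
  proof (rule ccontr)
    assume im: "Im x \<noteq> 0"
    then have nz: "poly (hermite k) x \<noteq> 0" using Suc.IH by blast
    obtain A where A: "\<And>a. a \<in># A \<longleftrightarrow> poly (hermite k) a = 0"
      and d: "poly (pderiv (hermite k)) x = poly (hermite k) x * (\<Sum>a\<in>#A. 1 / (x - a))"
      using complex_poly_log_derivs[OF hermite_nonzero[of k]] nz by metis
    define T where "T = (\<Sum>a\<in>#A. inverse (cmod (x - a) ^ 2))"
    have "Im (1 / (x - a)) = - Im x * inverse (cmod (x - a) ^ 2)" if "a \<in># A" for a
      using Suc.IH[of a] A that by (simp add: Im_divide cmod_power2 field_simps)
    then have "Im (\<Sum>a\<in>#A. 1 / (x - a)) = (\<Sum>a\<in>#A. - Im x * inverse (cmod (x - a) ^ 2))"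
      unfolding Im_sum_mset by (intro arg_cong[where f = sum_mset] image_mset_cong) auto
    also have "\<dots> = - Im x * T"
      unfolding T_def by (rule sum_mset_distrib_left[symmetric])
    finally have "Im (2 * x - (\<Sum>a\<in>#A. 1 / (x - a))) = Im x * (2 + T)"
      by (simp add: algebra_simps)
    \<comment> \<open>\<open>T\<close> is 0 when \<open>H_k\<close> has no zeros, as for
      \<open>k = 0\<close>; the summand 2 still keeps \<open>2 + T\<close> positive.\<close>
    moreover have "T \<ge> 0" unfolding T_def by (induction A) auto
    ultimately have "2 * x - (\<Sum>a\<in>#A. 1 / (x - a)) \<noteq> 0"
      using im by (metis add_pos_nonneg less_irrefl mult_eq_0_iff zero_complex.sel(2) zero_less_numeral)
    moreover have "poly (hermite (Suc k)) x
        = poly (hermite k) x * (2 * x - (\<Sum>a\<in>#A. 1 / (x - a)))"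
      by (simp add: hermite_Suc d algebra_simps)
    ultimately show False using nz Suc.prems by simp
  qed
qed

text \<open>The zeros are real and, by parity, symmetric about 0, so the maximal zero bounds them on
  both sides.\<close>

lemma hermite_zero_le_max_zero:
  assumes "poly (hermite k) a = 0"
  shows "\<bar>Re a\<bar> \<le> max_zero (hermite k)"
proof -
  define Z where "Z = {t. poly (hermite k) (complex_of_real t) = 0}"
  have "finite (complex_of_real ` Z)"
    by (rule finite_subset[OF _ poly_roots_finite[OF hermite_nonzero[of k]]]) (auto simp: Z_def)
  then have "finite Z" by (rule finite_imageD) (auto intro: inj_onI)
  have "a = of_real (Re a)" using hermite_zeros_real[OF assms] by (simp add: complex_eq_iff)
  then have "Re a \<in> Z" using assms unfolding Z_def by simp
  moreover from this have "- Re a \<in> Z" by (simp add: Z_def poly_hermite_minus)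
  ultimately have "Re a \<le> Max Z" "- Re a \<le> Max Z" using \<open>finite Z\<close> by simp_all
  then show ?thesis unfolding max_zero_def Z_def by simp
qed

section \<open>The Turan expression and its nonvanishing\<close>

lemma turan_hermite_eq:
  "2 * of_nat (Suc k) * turan hermite k x
     = poly (pderiv (hermite (Suc k))) x ^ 2
       - poly (hermite (Suc k)) x * poly (pderiv (pderiv (hermite (Suc k)))) x"
proof -
  define n :: complex where "n = of_nat (Suc k)"
  define h h0 h2 d dd where "h = poly (hermite (Suc k)) x" and "h0 = poly (hermite k) x"
    and "h2 = poly (hermite (Suc (Suc k))) x"
    and "d = poly (pderiv (hermite (Suc k))) x"
    and "dd = poly (pderiv (pderiv (hermite (Suc k)))) x"
  have "d = 2 * n * h0"
    unfolding d_def h0_def n_def pderiv_hermite_Suc by simp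
  moreover have h2: "h2 = 2 * x * h - d"
    unfolding h2_def h_def d_def by (simp add: hermite_Suc[of "Suc k"])
  \<comment> \<open>Hermite's differential equation, from computing the derivative of
    \<open>H_(k+2)\<close> in two ways.\<close>
  moreover have "dd = 2 * x * d - 2 * n * h"
  proof -
    have "2 * (n + 1) * h = poly (pderiv (hermite (Suc (Suc k)))) x"
      unfolding pderiv_hermite_Suc n_def h_def by (simp add: algebra_simps)
    also have "\<dots> = 2 * h + 2 * x * d - dd"
      unfolding hermite_Suc[of "Suc k"] pderiv_diff pderiv_linear_mult h_def d_def dd_def
      by (simp add: algebra_simps)
    finally show ?thesis by (simp add: algebra_simps)
  qed
  \<comment> \<open>Both sides equal \<open>2 * n * h^2 - d * h2\<close>.\<close>
  ultimately have "2 * n * (h ^ 2 - h2 * h0) = d ^ 2 - h * dd" by algebra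
  then show ?thesis
    unfolding turan_def by (simp add: n_def h_def h2_def h0_def d_def dd_def)
qed

lemma sum_inverse_squares_nonzero:
  assumes "A \<noteq> {#}"
    and real: "\<And>a. a \<in># A \<Longrightarrow> Im a = 0"
    and bound: "\<And>a. a \<in># A \<Longrightarrow> \<bar>Re a\<bar> < \<bar>Re x\<bar>"
  shows "(\<Sum>a\<in>#A. (1 / (x - a)) ^ 2) \<noteq> 0"
proof (cases "Im x = 0")
  case True
  have "Re ((1 / (x - a)) ^ 2) > 0" if "a \<in># A" for a
  proof -
    have "Im (1 / (x - a)) = 0" "Re (1 / (x - a)) \<noteq> 0"
      using True real[OF that] bound[OF that] by (auto simp: Im_divide Re_divide)
    then show ?thesis unfolding power2_eq_square times_complex.sel
      by (auto simp: zero_less_mult_iff linorder_neq_iff)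
  qed
  then have "Re (\<Sum>a\<in>#A. (1 / (x - a)) ^ 2) > 0"
    unfolding Re_sum_mset using assms(1) by (intro sum_mset_pos) auto
  then show ?thesis by auto
next
  case False
  \<comment> \<open>\<open>Im ((1 / (x - a))^2)\<close> has the sign of
    \<open>- Im x * (Re x - Re a)\<close>, and \<open>Re x - Re a\<close> has the sign of
    \<open>Re x\<close>. The factor \<open>c\<close> thus makes every term positive, whichever
    quadrant contains \<open>x\<close>.\<close>
  define c where "c = - Re x * Im x"
  have "c * Im ((1 / (x - a)) ^ 2) > 0" if "a \<in># A" for a
  proof -
    define N where "N = cmod (x - a) ^ 2"
    have "N > 0" using False real[OF that] unfolding N_def by auto
    have "Re (1 / (x - a)) = Re (x - a) / N" "Im (1 / (x - a)) = - Im x / N"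
      using real[OF that] by (simp_all add: N_def Re_divide Im_divide cmod_power2)
    then have "c * Im ((1 / (x - a)) ^ 2) = 2 * (Im x) ^ 2 * (Re x * (Re x - Re a)) / N ^ 2"
      unfolding Im_power2 by (simp add: c_def power2_eq_square)
    moreover have "Re x * (Re x - Re a) > 0"
      using bound[OF that] by (auto simp: zero_less_mult_iff abs_if split: if_splits)
    ultimately show ?thesis using False \<open>N > 0\<close> by simp
  qed
  then have "(\<Sum>a\<in>#A. c * Im ((1 / (x - a)) ^ 2)) > 0"
    using assms(1) by (intro sum_mset_pos) auto
  then have "c * Im (\<Sum>a\<in>#A. (1 / (x - a)) ^ 2) > 0"
    unfolding Im_sum_mset by (simp only: sum_mset_distrib_left)
  then show ?thesis by auto
qed

theorem corollary3p4:
  fixes k :: nat and x :: complex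
  assumes "\<bar>Re x\<bar> > max_zero (hermite (k + 1))"
  shows "turan hermite k x \<noteq> 0"
proof -
  define h where "h = hermite (Suc k)"
  have bound: "\<bar>Re a\<bar> < \<bar>Re x\<bar>" if "poly h a = 0" for a
    using hermite_zero_le_max_zero[of "Suc k" a] assms that unfolding h_def by simp
  \<comment> \<open>Taking \<open>a = x\<close> in \<open>bound\<close> would give
    \<open>\<bar>Re x\<bar> < \<bar>Re x\<bar>\<close>.\<close>
  then have nz: "poly h x \<noteq> 0" by blast
  obtain A where "size A = degree h" and A: "\<And>a. a \<in># A \<longleftrightarrow> poly h a = 0"
    and eq: "poly (pderiv h) x ^ 2 - poly h x * poly (pderiv (pderiv h)) x
      = poly h x ^ 2 * (\<Sum>a\<in>#A. (1 / (x - a)) ^ 2)"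
    using complex_poly_log_derivs[of h] hermite_nonzero[of "Suc k"] nz unfolding h_def by metis
  have "A \<noteq> {#}"
    using \<open>size A = degree h\<close> degree_hermite_Suc[of k] unfolding h_def by auto
  then have "(\<Sum>a\<in>#A. (1 / (x - a)) ^ 2) \<noteq> 0"
    using A bound hermite_zeros_real unfolding h_def by (intro sum_inverse_squares_nonzero) auto
  with nz eq have "2 * of_nat (Suc k) * turan hermite k x \<noteq> 0"
    unfolding turan_hermite_eq h_def by simp
  then show ?thesis by auto
qed

end
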